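(* Let $P=[b_1,\dots,b_N,\overline{a_1,\dots,a_k}]$ and $P'=[b'_1,\dots,b'_{N'},\overline{a'_1,\dots,a'_{k'}}]$ be periodic continued fractions of types $(N,k)$ and $(N',k')$ that are CF-equal. (1) If $k'=k$, then $E(P)=E(P')$, $\mathrm{Quad}(P)=\mathrm{Quad}(P')$ and $\mathrm{Roots}(P)=\mathrm{Roots}(P')$. (2) If $k'\neq k$, then $E(P)^{k'}=E(P')^{k}$, and $\mathrm{Quad}(P)$ and $\mathrm{Quad}(P')$ are linearly dependent; if $\mathrm{Quad}(P)$ and $\mathrm{Quad}(P')$ are both nonzero, then $\mathrm{Roots}(P)=\mathrm{Roots}(P')$. (3) $P$ converges if and only if $P'$ converges, and in this case their limits are equal: $\hat P=\hat P'\in\mathrm{Roots}(P)=\mathrm{Roots}(P')$.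
   Context: A periodic continued fraction (PCF) of type $(N,k)$ ($N\ge0,k\ge1$), $P=[b_1,\dots,b_N,\overline{a_1,\dots,a_k}]$ with entries in $\mathbb C$, is the infinite sequence of partial quotients $b_1,\dots,b_N,a_1,\dots,a_k,a_1,\dots,a_k,\dots$ together with the type. Two PCFs are CF-equal if their infinite sequences of partial quotients coincide (types may differ). Let $D(x)=\begin{bmatrix}x&1\\1&0\end{bmatrix}$ and $E(P)=BAB^{-1}$ with $B=D(b_1)\cdots D(b_N)$, $A=D(a_1)\cdots D(a_k)$. For $M=(m_{ij})$, $\mathrm{Quad}(M)=m_{21}X^2+(m_{22}-m_{11})X-m_{12}$; $\mathrm{Quad}(P):=\mathrm{Quad}(E(P))$. $\mathrm{Roots}(P)$ is the multiset of roots of $\mathrm{Quad}(P)$ in $\mathbb P^1(\mathbb C)$, with the conventions that a polynomial of degree $1$ has $\infty$ as a simple root, a nonzero constant has a double root at $\infty$, and $\mathrm{Roots}(0)=\mathbb P^1(\mathbb C)$. Convergents: $\mathcal C_n(P)=M_n(P)_{11}/M_n(P)_{21}\in\mathbb P^1(\mathbb C)$, where $M_n(P)$ is the product of $D(c_i)$ over the first $n$ partial quotients $c_i$; $P$ converges to $\hat P$ if $\mathcal C_n(P)\to\hat P$ in $\mathbb P^1(\mathbb C)$. *)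

theory Defs
  imports "HOL-Analysis.Analysis" "HOL-Computational_Algebra.Polynomial"
begin

text \<open>
  A PCF of type \<open>(N, k)\<close> is given by the list \<open>b\<^sub>1, \<dots>, b\<^sub>N\<close> and the list \<open>a\<^sub>1, \<dots>, a\<^sub>k\<close>.
  The sequence of partial quotients together with the type determines these lists and conversely.
\<close>

datatype pcf = PCF (preperiod: "complex list") (period: "complex list")

definition is_pcf :: "pcf \<Rightarrow> bool" where
  "is_pcf P \<longleftrightarrow> length (period P) \<ge> 1"

text \<open>The sequence of partial quotients is indexed from \<open>0\<close>.\<close>

definition partial_quotient :: "pcf \<Rightarrow> nat \<Rightarrow> complex" where
  "partial_quotient P i =
     (if i < length (preperiod P) then preperiod P ! i
      else period P ! ((i - length (preperiod P)) mod length (period P)))"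

definition cf_equal :: "pcf \<Rightarrow> pcf \<Rightarrow> bool" where
  "cf_equal P P' \<longleftrightarrow> (\<forall>i. partial_quotient P i = partial_quotient P' i)"

definition D :: "complex \<Rightarrow> complex^2^2" where
  "D x = vector [vector [x, 1], vector [1, 0]]"

definition prod_D :: "complex list \<Rightarrow> complex^2^2" where
  "prod_D cs = foldr (\<lambda>c M. D c ** M) cs (mat 1)"

definition E :: "pcf \<Rightarrow> complex^2^2" where
  "E P = prod_D (preperiod P) ** prod_D (period P) ** matrix_inv (prod_D (preperiod P))"

text \<open>The power operation of the library is componentwise multiplication on this type.\<close>

primrec matrix_power :: "complex^2^2 \<Rightarrow> nat \<Rightarrow> complex^2^2" where
  "matrix_power M 0 = mat 1"
| "matrix_power M (Suc n) = M ** matrix_power M n"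

definition Quad_matrix :: "complex^2^2 \<Rightarrow> complex poly" where
  "Quad_matrix M = [: - (M $ 1 $ 2), M $ 2 $ 2 - M $ 1 $ 1, M $ 2 $ 1 :]"

definition Quad :: "pcf \<Rightarrow> complex poly" where
  "Quad P = Quad_matrix (E P)"

definition linearly_dependent_polys :: "complex poly \<Rightarrow> complex poly \<Rightarrow> bool" where
  "linearly_dependent_polys p q \<longleftrightarrow>
     (\<exists>s t. (s \<noteq> 0 \<or> t \<noteq> 0) \<and> smult s p + smult t q = 0)"

text \<open>
  The complex projective line is the one-point compactification of the complex plane:
  \<open>Some z\<close> is the point \<open>[z : 1]\<close> and \<open>None\<close> is \<open>\<infinity> = [1 : 0]\<close>.
\<close>

type_synonym proj_line = "complex option"

definition proj_line_topology :: "proj_line topology" where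
  "proj_line_topology = Alexandroff_compactification euclidean"

text \<open>The point \<open>[x : y]\<close>, for \<open>(x, y) \<noteq> (0, 0)\<close>.\<close>

definition proj_quotient :: "complex \<Rightarrow> complex \<Rightarrow> proj_line" where
  "proj_quotient x y = (if y = 0 then None else Some (x / y))"

text \<open>
  Multisets of points of the projective line are given by their multiplicity functions, since the
  multiset of roots of the zero polynomial, the whole projective line, is infinite; there every
  point is counted once.  For a nonzero polynomial of degree at most \<open>2\<close>, the point at infinity
  has multiplicity \<open>2\<close> minus the degree.
\<close>

definition Roots_poly :: "complex poly \<Rightarrow> proj_line \<Rightarrow> nat" where
  "Roots_poly q v =
     (if q = 0 then 1
      else (case v of None \<Rightarrow> 2 - degree q | Some z \<Rightarrow> order z q))"

definition Roots :: "pcf \<Rightarrow> proj_line \<Rightarrow> nat" where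
  "Roots P = Roots_poly (Quad P)"

definition in_mset :: "proj_line \<Rightarrow> (proj_line \<Rightarrow> nat) \<Rightarrow> bool" where
  "in_mset v m \<longleftrightarrow> m v > 0"

definition convergent_matrix :: "pcf \<Rightarrow> nat \<Rightarrow> complex^2^2" where
  "convergent_matrix P n = prod_D (map (partial_quotient P) [0..<n])"

definition nth_convergent :: "pcf \<Rightarrow> nat \<Rightarrow> proj_line" where
  "nth_convergent P n =
     proj_quotient (convergent_matrix P n $ 1 $ 1) (convergent_matrix P n $ 2 $ 1)"

definition pcf_converges_to :: "pcf \<Rightarrow> proj_line \<Rightarrow> bool" where
  "pcf_converges_to P v \<longleftrightarrow> limitin proj_line_topology (nth_convergent P) v sequentially"

definition pcf_converges :: "pcf \<Rightarrow> bool" where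
  "pcf_converges P \<longleftrightarrow> (\<exists>v. pcf_converges_to P v)"

end

theory Submission
  imports Defs
begin

text \<open>
  Write \<open>M\<^sub>n\<close> for the product of the first \<open>n\<close> matrices \<open>D(c\<^sub>i)\<close>.  Every large \<open>n\<close> satisfies
  \<open>E(P) M\<^sub>n = M\<^bsub>n+k\<^esub>\<close>, and the right-hand side depends only on the sequence of partial quotients
  and on \<open>k\<close>.  Hence \<open>E(P)\<close> is determined by the sequence and \<open>k\<close>, both \<open>E(P)\<^bsup>k'\<^esup>\<close> and \<open>E(P')\<^bsup>k\<^esup>\<close>
  send \<open>M\<^sub>n\<close> to \<open>M\<^bsub>n+kk'\<^esub>\<close>, and \<open>E(P)\<close>, \<open>E(P')\<close> commute; commuting \<open>2 \<times> 2\<close> matrices have linearly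
  dependent quadratics.  A limit of the convergents is fixed by the Moebius map of \<open>E(P)\<close>, so it is a
  root of \<open>Quad(P)\<close>.  If \<open>Quad(P) = 0\<close>, then \<open>E(P)\<close> is scalar and the convergents are eventually
  periodic; were they to converge, they would be eventually constant, contradicting the
  invertibility of \<open>M\<^sub>n\<close>.
\<close>

section \<open>Two by two matrices\<close>

lemma matrix_inv_invertible:
  fixes A :: "'a::semiring_1^'n^'m"
  assumes "invertible A"
  shows "A ** matrix_inv A = mat 1" and "matrix_inv A ** A = mat 1"
  using someI_ex[OF assms[unfolded invertible_def]] unfolding matrix_inv_def by auto

text \<open>Reduces identities about \<open>E P\<close> and \<open>E P'\<close> to a comparison on
  one convergent matrix.\<close>

lemma invertible_matrix_cancel_right:
  fixes A B :: "'a::semiring_1^'n^'l" and M :: "'a^'n^'n"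
  assumes "invertible M" and "A ** M = B ** M"
  shows "A = B"
proof -
  have "A ** (M ** matrix_inv M) = B ** (M ** matrix_inv M)"
    by (metis assms(2) matrix_mul_assoc)
  then show ?thesis
    by (simp add: matrix_inv_invertible[OF assms(1)])
qed

lemma matrix_mult_2:
  fixes A B :: "'a::semiring_1^2^2"
  shows "(A ** B) $ i $ j = A $ i $ 1 * B $ 1 $ j + A $ i $ 2 * B $ 2 $ j"
  by (simp add: matrix_matrix_mult_def sum_2)

section \<open>Quadratics of commuting matrices and their roots\<close>

lemma Quad_matrix_eq_0:
  assumes "Quad_matrix M = 0"
  shows "M $ 1 $ 2 = 0" and "M $ 2 $ 1 = 0" and "M $ 2 $ 2 = M $ 1 $ 1"
  using assms by (auto simp: Quad_matrix_def split: if_splits)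

lemma linearly_dependent_polysI:
  assumes "s \<noteq> 0 \<or> t \<noteq> 0" and "smult s p + smult t q = 0"
  shows "linearly_dependent_polys p q"
  using assms unfolding linearly_dependent_polys_def by blast

text \<open>Up to sign, the entries of \<open>A ** B - B ** A\<close> are the 2 by 2 minors of the
  coefficient vectors of the two quadratics.\<close>

lemma linearly_dependent_Quad_matrix:
  assumes "A ** B = B ** A"
  shows "linearly_dependent_polys (Quad_matrix A) (Quad_matrix B)"
proof -
  have comm: "(A ** B) $ i $ j = (B ** A) $ i $ j" for i j
    using assms by simp
  have c1: "A $ 1 $ 2 * B $ 2 $ 1 = B $ 1 $ 2 * A $ 2 $ 1"
    using comm[of 1 1] by (simp add: matrix_mult_2 algebra_simps)
  have c2: "A $ 1 $ 2 * (B $ 2 $ 2 - B $ 1 $ 1) = B $ 1 $ 2 * (A $ 2 $ 2 - A $ 1 $ 1)"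
    using comm[of 1 2] unfolding matrix_mult_2 by algebra
  have c3: "A $ 2 $ 1 * (B $ 2 $ 2 - B $ 1 $ 1) = B $ 2 $ 1 * (A $ 2 $ 2 - A $ 1 $ 1)"
    using comm[of 2 1] unfolding matrix_mult_2 by algebra
  \<comment> \<open>A nonzero coefficient of the first quadratic, up to sign, multiplies the second
    one. The matching coefficient cancels by construction, the other two by the minors.\<close>
  consider "A $ 1 $ 2 \<noteq> 0" | "A $ 2 $ 1 \<noteq> 0" | "A $ 2 $ 2 - A $ 1 $ 1 \<noteq> 0" | "Quad_matrix A = 0"
    by (auto simp: Quad_matrix_def)
  then show ?thesis
  proof cases
    case 1
    then show ?thesis
      by (intro linearly_dependent_polysI[of "B $ 1 $ 2" "- (A $ 1 $ 2)"])
        (use c1 c2 in \<open>simp_all add: Quad_matrix_def algebra_simps\<close>)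
  next
    case 2
    then show ?thesis
      by (intro linearly_dependent_polysI[of "B $ 2 $ 1" "- (A $ 2 $ 1)"])
        (use c1 c3 in \<open>simp_all add: Quad_matrix_def algebra_simps\<close>)
  next
    case 3
    then show ?thesis
      by (intro linearly_dependent_polysI[of "B $ 2 $ 2 - B $ 1 $ 1" "A $ 1 $ 1 - A $ 2 $ 2"])
        (use c2 c3 in \<open>simp_all add: Quad_matrix_def algebra_simps\<close>)
  next
    case 4
    then show ?thesis
      by (intro linearly_dependent_polysI[of 1 0]) simp_all
  qed
qed

lemma Roots_poly_smult:
  assumes "c \<noteq> 0"
  shows "Roots_poly (smult c q) = Roots_poly q"
  using assms by (auto simp: Roots_poly_def fun_eq_iff order_smult split: option.splits)

lemma linearly_dependent_Roots_poly:
  assumes "linearly_dependent_polys p q" and "p \<noteq> 0" and "q \<noteq> 0"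
  shows "Roots_poly p = Roots_poly q"
proof -
  obtain s t where st: "s \<noteq> 0 \<or> t \<noteq> 0" "smult s p + smult t q = 0"
    using assms(1) unfolding linearly_dependent_polys_def by blast
  then have "s \<noteq> 0" "t \<noteq> 0"
    using assms(2,3) by auto
  have "smult s p = smult (- t) q"
    using st(2) by (simp add: eq_neg_iff_add_eq_0)
  then show ?thesis
    by (metis Roots_poly_smult \<open>s \<noteq> 0\<close> \<open>t \<noteq> 0\<close> neg_equal_0_iff_equal)
qed

section \<open>The action of E on the convergents\<close>

lemma prod_D_append: "prod_D (xs @ ys) = prod_D xs ** prod_D ys"
  by (induction xs) (simp_all add: prod_D_def matrix_mul_assoc)

lemma D_entries: "D x $ 1 $ 1 = x" "D x $ 1 $ 2 = 1" "D x $ 2 $ 1 = 1" "D x $ 2 $ 2 = 0"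
  by (simp_all add: D_def)

lemma invertible_D: "invertible (D x)"
  by (simp add: invertible_det_nz det_2 D_entries)

lemma invertible_prod_D: "invertible (prod_D cs)"
proof (induction cs)
  case Nil
  then show ?case by (simp add: prod_D_def invertible_det_nz)
next
  case (Cons c cs)
  then show ?case using invertible_D by (simp add: prod_D_def invertible_mult)
qed

lemma invertible_convergent_matrix: "invertible (convergent_matrix P n)"
  by (simp add: convergent_matrix_def invertible_prod_D)

lemma convergent_matrix_Suc:
  "convergent_matrix P (Suc n) = convergent_matrix P n ** D (partial_quotient P n)"
  by (simp add: convergent_matrix_def prod_D_append) (simp add: prod_D_def)

lemma partial_quotient_add_period:
  assumes "length (preperiod P) \<le> n"
  shows "partial_quotient P (n + length (period P)) = partial_quotient P n"
proof -
  have "n + length (period P) - length (preperiod P)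
      = (n - length (preperiod P)) + length (period P)"
    using assms by simp
  then show ?thesis
    using assms unfolding partial_quotient_def by (metis mod_add_self2 not_less trans_le_add1)
qed

text \<open>At the end of the preperiod, the inverse in \<open>E P\<close> cancels
  \<open>prod_D (preperiod P)\<close>. Each further step multiplies both sides on the right by the
  same \<open>D\<close>, since the partial quotients repeat.\<close>

lemma E_mult_convergent_matrix:
  assumes "length (preperiod P) \<le> n"
  shows "E P ** convergent_matrix P n = convergent_matrix P (n + length (period P))"
  using assms
proof (induction n rule: dec_induct)
  case base
  have pre: "map (partial_quotient P) [0..<length (preperiod P)] = preperiod P"
    by (rule nth_equalityI) (auto simp: partial_quotient_def)
  have "map (partial_quotient P) [0..<length (preperiod P) + length (period P)]
      = preperiod P @ period P"
    by (rule nth_equalityI) (auto simp: partial_quotient_def nth_append)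
  then show ?case
    by (simp add: convergent_matrix_def pre E_def prod_D_append matrix_mul_assoc[symmetric]
        matrix_inv_invertible[OF invertible_prod_D])
next
  case (step n)
  then show ?case
    by (simp add: convergent_matrix_Suc matrix_mul_assoc partial_quotient_add_period)
qed

lemma matrix_power_E_mult_convergent_matrix:
  assumes "length (preperiod P) \<le> n"
  shows "matrix_power (E P) j ** convergent_matrix P n = convergent_matrix P (n + j * length (period P))"
proof (induction j)
  case (Suc j)
  have "matrix_power (E P) (Suc j) ** convergent_matrix P n
      = E P ** convergent_matrix P (n + j * length (period P))"
    using Suc by (simp add: matrix_mul_assoc[symmetric])
  also have "\<dots> = convergent_matrix P (n + j * length (period P) + length (period P))"
    using assms by (intro E_mult_convergent_matrix) simp
  finally show ?case by (simp add: algebra_simps)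
qed simp

section \<open>Matrices of CF-equal fractions\<close>

lemma cf_equal_convergent_matrix:
  assumes "cf_equal P P'"
  shows "convergent_matrix P = convergent_matrix P'"
  using assms by (simp add: cf_equal_def convergent_matrix_def fun_eq_iff cong: map_cong)

lemma cf_equal_E:
  assumes "cf_equal P P'" and "length (period P) = length (period P')"
  shows "E P = E P'"
proof -
  \<comment> \<open>Beyond both preperiods, \<open>E P\<close> and \<open>E P'\<close> shift the
    same convergent matrices.\<close>
  define n where "n = max (length (preperiod P)) (length (preperiod P'))"
  have "E P ** convergent_matrix P n = E P' ** convergent_matrix P n"
    using assms E_mult_convergent_matrix[of P n] E_mult_convergent_matrix[of P' n]
    by (simp add: n_def cf_equal_convergent_matrix[OF assms(1)])
  then show ?thesis
    by (rule invertible_matrix_cancel_right[OF invertible_convergent_matrix])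
qed

lemma cf_equal_matrix_power_E:
  assumes "cf_equal P P'"
  shows "matrix_power (E P) (length (period P')) = matrix_power (E P') (length (period P))"
proof -
  define n where "n = max (length (preperiod P)) (length (preperiod P'))"
  have "matrix_power (E P) (length (period P')) ** convergent_matrix P n
      = matrix_power (E P') (length (period P)) ** convergent_matrix P n"
    using assms matrix_power_E_mult_convergent_matrix[of P n]
      matrix_power_E_mult_convergent_matrix[of P' n]
    by (simp add: n_def cf_equal_convergent_matrix[OF assms] mult.commute)
  then show ?thesis
    by (rule invertible_matrix_cancel_right[OF invertible_convergent_matrix])
qed

lemma cf_equal_E_commute:
  assumes "cf_equal P P'"
  shows "E P ** E P' = E P' ** E P"
proof -
  define n where "n = max (length (preperiod P)) (length (preperiod P'))"
  \<comment> \<open>All later indices are needed, because the second factor acts at an index already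
    shifted by the first. Either order shifts by the sum of the period lengths.\<close>
  have E: "E P ** convergent_matrix P m = convergent_matrix P (m + length (period P))"
    "E P' ** convergent_matrix P m = convergent_matrix P (m + length (period P'))" if "n \<le> m" for m
    using that assms E_mult_convergent_matrix[of P m] E_mult_convergent_matrix[of P' m]
    by (simp_all add: n_def cf_equal_convergent_matrix[OF assms])
  have "(E P ** E P') ** convergent_matrix P n = (E P' ** E P) ** convergent_matrix P n"
    by (simp add: matrix_mul_assoc[symmetric] E algebra_simps)
  then show ?thesis
    by (rule invertible_matrix_cancel_right[OF invertible_convergent_matrix])
qed

lemma cf_equal_linearly_dependent_Quad:
  assumes "cf_equal P P'"
  shows "linearly_dependent_polys (Quad P) (Quad P')"
  unfolding Quad_def using assms by (intro linearly_dependent_Quad_matrix cf_equal_E_commute)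

section \<open>Limits on the projective line\<close>

lemma limitin_proj_line_unique:
  assumes "limitin proj_line_topology f v sequentially"
    and "limitin proj_line_topology f w sequentially"
  shows "v = w"
proof -
  have "Hausdorff_space proj_line_topology"
    unfolding proj_line_topology_def
    by (simp add: Hausdorff_space_Alexandroff_compactification locally_compact_space_euclidean)
  then show ?thesis
    using assms by (metis limitin_Hausdorff_unique trivial_limit_sequentially)
qed

lemma limitin_proj_line_Some:
  assumes "limitin proj_line_topology (\<lambda>n. proj_quotient (x n) (y n)) (Some z) sequentially"
  shows "eventually (\<lambda>n. y n \<noteq> 0) sequentially" and "(\<lambda>n. x n / y n) \<longlonglongrightarrow> z"
proof -
  have ev: "eventually (\<lambda>n. y n \<noteq> 0 \<and> x n / y n \<in> U) sequentially" if "open U" "z \<in> U" for U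
  proof -
    \<comment> \<open>This neighbourhood omits \<open>None\<close>, so membership in it also forces
      a nonzero denominator.\<close>
    have "openin proj_line_topology (Some ` U)"
      using that by (simp add: proj_line_topology_def)
    then have "eventually (\<lambda>n. proj_quotient (x n) (y n) \<in> Some ` U) sequentially"
      using assms that unfolding limitin_def by blast
    then show ?thesis
      by eventually_elim (auto simp: proj_quotient_def split: if_splits)
  qed
  show "eventually (\<lambda>n. y n \<noteq> 0) sequentially"
    using ev[of UNIV] by simp
  show "(\<lambda>n. x n / y n) \<longlonglongrightarrow> z"
  proof (rule topological_tendstoI)
    fix U :: "complex set" assume "open U" "z \<in> U"
    from ev[OF this] show "eventually (\<lambda>n. x n / y n \<in> U) sequentially"
      by eventually_elim simp
  qed
qed

text \<open>The coordinate near infinity is \<open>y n / x n\<close>: outside the closed ball of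
  radius \<open>1 / e\<close> it has norm below \<open>e\<close>. The assumption \<open>nz\<close>
  excludes the pair \<open>(0, 0)\<close>, which \<open>proj_quotient\<close> also sends to
  \<open>None\<close>.\<close>

lemma limitin_proj_line_None:
  assumes lim: "limitin proj_line_topology (\<lambda>n. proj_quotient (x n) (y n)) None sequentially"
    and nz: "\<And>n. x n \<noteq> 0 \<or> y n \<noteq> 0"
  shows "eventually (\<lambda>n. x n \<noteq> 0) sequentially" and "(\<lambda>n. y n / x n) \<longlonglongrightarrow> 0"
proof -
  have ev: "eventually (\<lambda>n. x n \<noteq> 0 \<and> norm (y n / x n) < e) sequentially" if "e > 0" for e
  proof -
    have "openin proj_line_topology (insert None (Some ` (topspace euclidean - cball 0 (1 / e))))"
      unfolding proj_line_topology_def openin_Alexandroff_compactification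
      by (intro disjI2 exI[of _ "cball 0 (1 / e)"]) auto
    then have "eventually (\<lambda>n. proj_quotient (x n) (y n)
        \<in> insert None (Some ` (topspace euclidean - cball 0 (1 / e)))) sequentially"
      using lim unfolding limitin_def by blast
    then show ?thesis
    proof eventually_elim
      case (elim n)
      show ?case
      proof (cases "y n = 0")
        case True
        then show ?thesis using nz[of n] that by simp
      next
        case False
        with elim have *: "1 / e < norm (x n / y n)"
          by (auto simp: proj_quotient_def)
        with that have "x n \<noteq> 0"
          by (auto simp: field_simps)
        with False * that show ?thesis
          by (simp add: norm_divide field_simps)
      qed
    qed
  qed
  show "eventually (\<lambda>n. x n \<noteq> 0) sequentially"
    using ev[of 1] by (auto elim: eventually_mono)
  show "(\<lambda>n. y n / x n) \<longlonglongrightarrow> 0"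
  proof (rule tendstoI)
    fix e :: real assume "e > 0"
    from ev[OF this] show "eventually (\<lambda>n. dist (y n / x n) 0 < e) sequentially"
      by eventually_elim simp
  qed
qed

text \<open>The subsequence along \<open>n + j * k\<close> is constant and keeps the limit
  \<open>v\<close>.\<close>

lemma limitin_proj_line_eventually_periodic:
  assumes lim: "limitin proj_line_topology f v sequentially"
    and per: "\<And>n. n \<ge> N \<Longrightarrow> f (n + k) = f n" and "k > 0" and "n \<ge> N"
  shows "f n = v"
proof -
  have f: "f (n + j * k) = f n" for j
  proof (induction j)
    case (Suc j)
    have "f (n + Suc j * k) = f ((n + j * k) + k)"
      by (simp add: algebra_simps)
    then show ?case
      using per[of "n + j * k"] Suc \<open>n \<ge> N\<close> by simp
  qed simp
  have "strict_mono (\<lambda>j. n + j * k)"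
    using \<open>k > 0\<close> by (simp add: strict_mono_def)
  from limitin_subsequence[OF this lim]
  have "limitin proj_line_topology (\<lambda>j. f n) v sequentially"
    by (simp add: o_def f)
  moreover have "limitin proj_line_topology (\<lambda>j. f n) (f n) sequentially"
    unfolding limitin_const_iff by (cases "f n") (simp_all add: proj_line_topology_def)
  ultimately show ?thesis
    using limitin_proj_line_unique by blast
qed

text \<open>Cross-multiplication also covers infinity, where both denominators vanish and both
  products are zero.\<close>

lemma proj_quotient_eq_det:
  assumes "proj_quotient x y = proj_quotient x' y'"
  shows "x * y' = x' * y"
  using assms by (auto simp: proj_quotient_def field_simps split: if_splits)

section \<open>Convergence\<close>

lemma cf_equal_converges_to:
  assumes "cf_equal P P'"
  shows "pcf_converges_to P = pcf_converges_to P'"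
proof -
  have "nth_convergent P = nth_convergent P'"
    using cf_equal_convergent_matrix[OF assms] by (simp add: nth_convergent_def fun_eq_iff)
  then show ?thesis
    by (intro ext) (simp add: pcf_converges_to_def)
qed

section \<open>Limits of the convergents and roots of the quadratic\<close>

lemma convergent_matrix_det: "det (convergent_matrix P n) \<noteq> 0"
  using invertible_convergent_matrix invertible_det_nz by blast

lemma convergent_matrix_add_period:
  assumes "length (preperiod P) \<le> n"
  shows "convergent_matrix P (n + length (period P)) $ i $ j
    = E P $ i $ 1 * convergent_matrix P n $ 1 $ j + E P $ i $ 2 * convergent_matrix P n $ 2 $ j"
  using E_mult_convergent_matrix[OF assms] matrix_mult_2 by metis

text \<open>The two convergents are the points given by the columns of the invertible matrix
  \<open>convergent_matrix P (Suc n)\<close>.\<close>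

lemma nth_convergent_Suc_neq: "nth_convergent P (Suc n) \<noteq> nth_convergent P n"
proof
  let ?M = "convergent_matrix P"
  assume "nth_convergent P (Suc n) = nth_convergent P n"
  then have "?M (Suc n) $ 1 $ 1 * ?M n $ 2 $ 1 = ?M n $ 1 $ 1 * ?M (Suc n) $ 2 $ 1"
    unfolding nth_convergent_def by (rule proj_quotient_eq_det)
  moreover have "?M (Suc n) $ i $ 2 = ?M n $ i $ 1" for i
    by (simp add: convergent_matrix_Suc matrix_mult_2 D_entries)
  ultimately have "det (?M (Suc n)) = 0"
    by (simp add: det_2)
  then show False
    using convergent_matrix_det by blast
qed

lemma converges_to_Quad_nonzero:
  assumes "is_pcf P" and lim: "pcf_converges_to P v"
  shows "Quad P \<noteq> 0"
proof
  assume "Quad P = 0"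
  note Q = Quad_matrix_eq_0[OF this[unfolded Quad_def]]
  let ?N = "length (preperiod P)" and ?k = "length (period P)" and ?M = "convergent_matrix P"
  have "nth_convergent P (n + ?k) = nth_convergent P n" if "n \<ge> ?N" for n
  proof -
    have M: "?M (n + ?k) $ i $ 1 = E P $ 1 $ 1 * ?M n $ i $ 1" for i
      using convergent_matrix_add_period[OF that, of i 1] Q exhaust_2[of i] by auto
    \<comment> \<open>A zero scalar would annihilate the first column of an invertible
      matrix.\<close>
    have "E P $ 1 $ 1 \<noteq> 0"
      using M[of 1] M[of 2] convergent_matrix_det[of P "n + ?k"] by (auto simp: det_2)
    then show ?thesis
      by (simp add: nth_convergent_def M proj_quotient_def)
  qed
  then have "nth_convergent P n = v" if "n \<ge> ?N" for n
    using assms that unfolding is_pcf_def pcf_converges_to_def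
    by (intro limitin_proj_line_eventually_periodic[of "nth_convergent P" v ?N ?k n]) auto
  then show False
    using nth_convergent_Suc_neq[of P ?N] by simp
qed

text \<open>The two forms fit the Moebius map of \<open>E P\<close> in the coordinate
  \<open>x / y\<close> for a finite limit and in \<open>y / x\<close> at infinity.\<close>

lemma add_fraction_common_denominator:
  fixes u v c d :: "'a::field"
  assumes "v \<noteq> 0"
  shows "c * (u / v) + d = (c * u + d * v) / v" and "d + c * (u / v) = (d * v + c * u) / v"
  using assms by (simp_all add: add_divide_distrib)

lemma LIMSEQ_eventually_eq_unique:
  fixes f g :: "nat \<Rightarrow> 'a::t2_space"
  assumes "f \<longlonglongrightarrow> l" and "g \<longlonglongrightarrow> m" and "eventually (\<lambda>n. f n = g n) sequentially"
  shows "m = l"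
  using LIMSEQ_unique[OF assms(2) Lim_transform_eventually[OF assms(1,3)]] .

text \<open>Passing to the limit in the shift by one period makes \<open>v\<close> a fixed point of
  the Moebius map of \<open>E P\<close>, and such fixed points are roots of
  \<open>Quad P\<close>.\<close>

lemma converges_to_root:
  assumes "is_pcf P" and lim: "pcf_converges_to P v"
  shows "in_mset v (Roots P)"
proof -
  let ?N = "length (preperiod P)" and ?k = "length (period P)"
  define x where "x n = convergent_matrix P n $ 1 $ 1" for n
  define y where "y n = convergent_matrix P n $ 2 $ 1" for n
  define a b c d where "a = E P $ 1 $ 1" and "b = E P $ 1 $ 2" and "c = E P $ 2 $ 1" and "d = E P $ 2 $ 2"
  have rec: "eventually (\<lambda>n. x (n + ?k) = a * x n + b * y n \<and> y (n + ?k) = c * x n + d * y n) sequentially"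
    using eventually_ge_at_top[of ?N]
    by eventually_elim
      (simp add: x_def y_def a_def b_def c_def d_def convergent_matrix_add_period)
  have lim': "limitin proj_line_topology (\<lambda>n. proj_quotient (x n) (y n)) v sequentially"
    using lim by (simp add: pcf_converges_to_def nth_convergent_def[abs_def] x_def y_def)
  have nz: "x n \<noteq> 0 \<or> y n \<noteq> 0" for n
    using convergent_matrix_det[of P n] by (auto simp: x_def y_def det_2)
  have Q: "Quad P = [: - b, d - a, c :]" "Quad P \<noteq> 0"
    using converges_to_Quad_nonzero[OF assms]
    by (simp_all add: Quad_def Quad_matrix_def a_def b_def c_def d_def)
  show ?thesis
  proof (cases v)
    case (Some z)
    note L = limitin_proj_line_Some[OF lim'[unfolded Some]]
    have ny: "eventually (\<lambda>n. y (n + ?k) \<noteq> 0) sequentially"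
      using L(1) by (rule sequentially_offset)
    \<comment> \<open>The denominator of the Moebius map is cleared first, as its limit
      \<open>c * z + d\<close> is not known to be nonzero.\<close>
    have "(\<lambda>n. x (n + ?k) / y (n + ?k) * (c * (x n / y n) + d)) \<longlonglongrightarrow> z * (c * z + d)"
      by (intro tendsto_intros L(2) LIMSEQ_ignore_initial_segment[OF L(2)])
    moreover have "(\<lambda>n. a * (x n / y n) + b) \<longlonglongrightarrow> a * z + b"
      by (intro tendsto_intros L(2))
    moreover have "eventually (\<lambda>n. x (n + ?k) / y (n + ?k) * (c * (x n / y n) + d)
        = a * (x n / y n) + b) sequentially"
      using L(1) ny rec
    proof eventually_elim
      case (elim n)
      have "c * (x n / y n) + d = y (n + ?k) / y n" "a * (x n / y n) + b = x (n + ?k) / y n"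
        using elim add_fraction_common_denominator(1)[of "y n" _ "x n"] by metis+
      then show ?case using elim(1,2) by simp
    qed
    ultimately have "a * z + b = z * (c * z + d)"
      by (rule LIMSEQ_eventually_eq_unique)
    then have "poly (Quad P) z = 0"
      unfolding Q(1) by (simp add: algebra_simps)
    then show ?thesis
      using Q(2) Some by (simp add: in_mset_def Roots_def Roots_poly_def order_root)
  next
    case None
    note L = limitin_proj_line_None[OF lim'[unfolded None] nz]
    have nx: "eventually (\<lambda>n. x (n + ?k) \<noteq> 0) sequentially"
      using L(1) by (rule sequentially_offset)
    \<comment> \<open>In the coordinate \<open>y / x\<close> the limit is \<open>0\<close>, so the
      cleared relation leaves \<open>c = 0\<close>: the degree drops and infinity is a root.\<close>
    have "(\<lambda>n. y (n + ?k) / x (n + ?k) * (a + b * (y n / x n))) \<longlonglongrightarrow> 0 * (a + b * 0)"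
      by (intro tendsto_intros L(2) LIMSEQ_ignore_initial_segment[OF L(2)])
    moreover have "(\<lambda>n. c + d * (y n / x n)) \<longlonglongrightarrow> c + d * 0"
      by (intro tendsto_intros L(2))
    moreover have "eventually (\<lambda>n. y (n + ?k) / x (n + ?k) * (a + b * (y n / x n))
        = c + d * (y n / x n)) sequentially"
      using L(1) nx rec
    proof eventually_elim
      case (elim n)
      have "a + b * (y n / x n) = x (n + ?k) / x n" "c + d * (y n / x n) = y (n + ?k) / x n"
        using elim add_fraction_common_denominator(2)[of "x n" _ _ "y n"] by metis+
      then show ?case using elim(1,2) by simp
    qed
    ultimately have "c + d * 0 = 0 * (a + b * 0)"
      by (rule LIMSEQ_eventually_eq_unique)
    then have "degree (Quad P) < 2"
      unfolding Q(1) by simp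
    then show ?thesis
      using Q(2) None by (simp add: in_mset_def Roots_def Roots_poly_def)
  qed
qed

theorem theorem7p1:
  fixes P P' :: pcf and k k' :: nat
  assumes "is_pcf P" and "is_pcf P'"
    and "k = length (period P)" and "k' = length (period P')"
    and "cf_equal P P'"
  shows "(k' = k \<longrightarrow> E P = E P' \<and> Quad P = Quad P' \<and> Roots P = Roots P')
    \<and> (k' \<noteq> k \<longrightarrow>
         matrix_power (E P) k' = matrix_power (E P') k
         \<and> linearly_dependent_polys (Quad P) (Quad P')
         \<and> (Quad P \<noteq> 0 \<and> Quad P' \<noteq> 0 \<longrightarrow> Roots P = Roots P'))
    \<and> (pcf_converges P \<longleftrightarrow> pcf_converges P')
    \<and> (\<forall>v v'. pcf_converges_to P v \<and> pcf_converges_to P' v' \<longrightarrow>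
         v = v' \<and> in_mset v (Roots P) \<and> Roots P = Roots P')"
proof -
  have roots: "Roots P = Roots P'" if "Quad P \<noteq> 0" "Quad P' \<noteq> 0"
    unfolding Roots_def
    using linearly_dependent_Roots_poly[OF cf_equal_linearly_dependent_Quad] assms(5) that by blast
  have "E P = E P' \<and> Quad P = Quad P' \<and> Roots P = Roots P'" if "k' = k"
    using cf_equal_E[OF assms(5)] that assms(3,4) by (simp add: Quad_def Roots_def)
  moreover have "matrix_power (E P) k' = matrix_power (E P') k"
    using cf_equal_matrix_power_E[OF assms(5)] assms(3,4) by simp
  moreover have "pcf_converges P \<longleftrightarrow> pcf_converges P'"
    using cf_equal_converges_to[OF assms(5)] by (simp add: pcf_converges_def)
  moreover have "v = v' \<and> in_mset v (Roots P) \<and> Roots P = Roots P'"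
    if "pcf_converges_to P v" "pcf_converges_to P' v'" for v v'
  proof (intro conjI)
    show "v = v'"
      using that unfolding cf_equal_converges_to[OF assms(5)] pcf_converges_to_def
      by (rule limitin_proj_line_unique)
    show "in_mset v (Roots P)"
      using assms(1) that(1) by (rule converges_to_root)
    \<comment> \<open>Convergence makes both quadratics nonzero, so the roots agree even for
      different period lengths.\<close>
    show "Roots P = Roots P'"
      using that assms(1,2) by (intro roots converges_to_Quad_nonzero)
  qed
  ultimately show ?thesis
    using roots cf_equal_linearly_dependent_Quad[OF assms(5)] by blast
qed

end
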